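(* Let $(L_n)_{n\in\mathbb{N}}$ be a sequence of operators with $L_n\in\Lambda$ for every $n\in\mathbb{N}$. With $M_n^k$, $\alpha_n$, $\nu_n$, $\eta_n$ as defined in the context, assume that, as $n\to\infty$, $$M_n^4(x)=\mathrm{o}(M_n^2(x))\quad\text{uniformly with regard to } x\in[0,1],\qquad \eta_n=\mathrm{o}(1),$$ and $$L_n\big(\psi\,|\alpha_n-\alpha_n(x)e_0|\big)(x)=\mathrm{o}\big(\nu_n^{2}\,\psi(x)\big)\quad\text{uniformly for } x\in[0,1].$$ (Here "$A_n(x)=\mathrm{o}(B_n(x))$ uniformly" means that there is a sequence of positive numbers $c_n\to0$ with $A_n(x)\le c_nB_n(x)$ for all $x\in[0,1]$, $n\in\mathbb{N}$.) Let $f\in C_\psi[0,1]+\Pi_1$ and suppose that there is a function $g\in C(0,1)\cap B[0,1]$ such that $$\lim_{n\to\infty}\left\|\frac1{\alpha_n}\big(L_n(f)-f\big)-g\psi\right\|_{\psi}=0 .$$ Then $f\in C^2(0,1)$ and $g(x)=\frac12 f''(x)$ for all $x\in(0,1)$.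
   Context: $C[0,1]$ is the space of continuous functions $[0,1]\to\mathbb{R}$; $B[0,1]$ is the space of bounded functions $[0,1]\to\mathbb{R}$; $C^k(0,1)$ denotes the set of functions $f:[0,1]\to\mathbb{R}$ having a continuous $k$-th derivative on $(0,1)$, and $C(0,1)=C^0(0,1)$ (functions on $[0,1]$ continuous on $(0,1)$). $\Pi_1$ is the set of polynomial functions of degree at most $1$ on $[0,1]$. $e_j(t)=t^j$ on $[0,1]$, and $\psi(x)=x(1-x)$, $x\in[0,1]$. $C_\psi[0,1]=\{f:[0,1]\to\mathbb{R}\mid \exists g\in B[0,1]\cap C(0,1):\ f=\psi g\}$ (equivalently, the $f\in C[0,1]$ for which there is $M>0$ with $|f|\le M\psi$), with norm $\|f\|_\psi=\sup_{x\in(0,1)}|f(x)|/\psi(x)$. For sets of functions, $X+Y=\{f+g\mid f\in X,\ g\in Y\}$. $B_1(f)(x)=(1-x)f(0)+xf(1)$ is the Bernstein operator of order one. $\Lambda$ is the class of all positive linear operators $L:C[0,1]\to C[0,1]$ such that (a) $L$ preserves linear functions ($L e_0=e_0$, $Le_1=e_1$); (b) $\|L(\psi)\|_\psi<1$; (c) $L\neq B_1$. For $L\in\Lambda$, $b_L:[0,1]\to\mathbb{R}$ is given by $b_L(x)=L(\psi)(x)/\psi(x)$ for $x\in(0,1)$ and $b_L(x)=\|L(\psi)\|_\psi$ for $x\in\{0,1\}$. For the sequence $(L_n)$: $\alpha_n=1-b_{L_n}$, $\nu_n=\min_{x\in[0,1]}\alpha_n(x)$, $\eta_n=\sup_{x,y\in[0,1]}|\alpha_n(x)-\alpha_n(y)|/\nu_n$,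 and $M_n^k(x)=L_n((e_1-xe_0)^k)(x)$ for $x\in[0,1]$, $k\in\mathbb{N}\cup\{0\}$ (the superscript is an index; $M_n^2=\alpha_n\psi$). *)

theory Defs
  imports "HOL-Analysis.Analysis" "HOL-Library.Function_Algebras" "HOL-Library.Set_Algebras"
    "HOL-Library.Landau_Symbols" "HOL-Computational_Algebra.Polynomial"
begin

text \<open>
  Functions \<open>[0,1] \<rightarrow> \<real>\<close> are represented by functions of type \<open>real \<Rightarrow> real\<close> of which only the
  values on \<open>{0..1}\<close> matter. The function spaces below do not restrict the values elsewhere, and
  equality of functions always means equality on \<open>{0..1}\<close>.
\<close>

definition C01 :: "(real \<Rightarrow> real) set"
  where "C01 = {f. continuous_on {0..1} f}"

definition B01 :: "(real \<Rightarrow> real) set"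
  where "B01 = {f. bounded (f ` {0..1})}"

text \<open>\<open>(0,1)\<close> is open, so the iterated \<open>deriv\<close> depends only on the values of \<open>f\<close> there.\<close>

definition C_open :: "nat \<Rightarrow> (real \<Rightarrow> real) set"
  where "C_open k = {f. (\<forall>j<k. \<forall>x\<in>{0<..<1}. (deriv ^^ j) f differentiable (at x)) \<and>
                        continuous_on {0<..<1} ((deriv ^^ k) f)}"

definition Pi1 :: "(real \<Rightarrow> real) set"
  where "Pi1 = {f. \<exists>p. degree p \<le> 1 \<and> (\<forall>x\<in>{0..1}. f x = poly p x)}"

definition e :: "nat \<Rightarrow> real \<Rightarrow> real"
  where "e j t = t ^ j"

definition psi :: "real \<Rightarrow> real"
  where "psi x = x * (1 - x)"

definition C_psi :: "(real \<Rightarrow> real) set"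
  where "C_psi = {f. \<exists>g \<in> B01 \<inter> C_open 0. \<forall>x\<in>{0..1}. f x = psi x * g x}"

text \<open>
  This real-valued supremum is meaningful when \<open>\<bar>f\<bar> / psi\<close> is bounded on \<open>(0,1)\<close>, in particular
  on \<open>C_psi\<close>. For \<open>f = L psi\<close> with \<open>L\<close> positive and preserving linear functions this is always the
  case, by \<open>0 \<le> L psi \<le> psi\<close>.
\<close>

definition norm_psi :: "(real \<Rightarrow> real) \<Rightarrow> real"
  where "norm_psi f = (SUP x\<in>{0<..<1}. \<bar>f x\<bar> / psi x)"

definition positive_linear_operator :: "((real \<Rightarrow> real) \<Rightarrow> (real \<Rightarrow> real)) \<Rightarrow> bool"
  where "positive_linear_operator L \<longleftrightarrow>
    (\<forall>f\<in>C01. L f \<in> C01) \<and>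
    (\<forall>f\<in>C01. \<forall>g\<in>C01. \<forall>x\<in>{0..1}. L (\<lambda>t. f t + g t) x = L f x + L g x) \<and>
    (\<forall>c. \<forall>f\<in>C01. \<forall>x\<in>{0..1}. L (\<lambda>t. c * f t) x = c * L f x) \<and>
    (\<forall>f\<in>C01. (\<forall>x\<in>{0..1}. 0 \<le> f x) \<longrightarrow> (\<forall>x\<in>{0..1}. 0 \<le> L f x))"

definition preserves_linear :: "((real \<Rightarrow> real) \<Rightarrow> (real \<Rightarrow> real)) \<Rightarrow> bool"
  where "preserves_linear L \<longleftrightarrow> (\<forall>x\<in>{0..1}. L (e 0) x = e 0 x \<and> L (e 1) x = e 1 x)"

definition bernstein1 :: "(real \<Rightarrow> real) \<Rightarrow> (real \<Rightarrow> real)"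
  where "bernstein1 f x = (1 - x) * f 0 + x * f 1"

definition Lambda :: "((real \<Rightarrow> real) \<Rightarrow> (real \<Rightarrow> real)) set"
  where "Lambda = {L. positive_linear_operator L \<and> preserves_linear L \<and> norm_psi (L psi) < 1 \<and>
                      (\<exists>f\<in>C01. \<exists>x\<in>{0..1}. L f x \<noteq> bernstein1 f x)}"

definition b :: "((real \<Rightarrow> real) \<Rightarrow> (real \<Rightarrow> real)) \<Rightarrow> real \<Rightarrow> real"
  where "b L x = (if x \<in> {0<..<1} then L psi x / psi x else norm_psi (L psi))"

definition alpha :: "((real \<Rightarrow> real) \<Rightarrow> (real \<Rightarrow> real)) \<Rightarrow> real \<Rightarrow> real"
  where "alpha L x = 1 - b L x"

text \<open>For \<open>L \<in> Lambda\<close> the infimum is a minimum, see \<open>nu_minimum\<close> below.\<close>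

definition nu :: "((real \<Rightarrow> real) \<Rightarrow> (real \<Rightarrow> real)) \<Rightarrow> real"
  where "nu L = (INF x\<in>{0..1}. alpha L x)"

definition eta :: "((real \<Rightarrow> real) \<Rightarrow> (real \<Rightarrow> real)) \<Rightarrow> real"
  where "eta L = (SUP (x, y)\<in>{0..1} \<times> {0..1}. \<bar>alpha L x - alpha L y\<bar>) / nu L"

definition moment :: "((real \<Rightarrow> real) \<Rightarrow> (real \<Rightarrow> real)) \<Rightarrow> nat \<Rightarrow> real \<Rightarrow> real"
  where "moment L k x = L (\<lambda>t. (e 1 t - x * e 0 t) ^ k) x"

definition unif_smallo :: "(nat \<Rightarrow> real \<Rightarrow> real) \<Rightarrow> (nat \<Rightarrow> real \<Rightarrow> real) \<Rightarrow> bool"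
  where "unif_smallo A B \<longleftrightarrow>
    (\<exists>c :: nat \<Rightarrow> real. (\<forall>n. 0 < c n) \<and> c \<longlonglongrightarrow> 0 \<and> (\<forall>n. \<forall>x\<in>{0..1}. A n x \<le> c n * B n x))"

lemma
  assumes "positive_linear_operator L" and "f \<in> C01" and "x \<in> {0..1}"
  shows operator_add: "g \<in> C01 \<Longrightarrow> L (\<lambda>t. f t + g t) x = L f x + L g x"
    and operator_scale: "L (\<lambda>t. c * f t) x = c * L f x"
    and operator_nonneg: "(\<And>t. t \<in> {0..1} \<Longrightarrow> 0 \<le> f t) \<Longrightarrow> 0 \<le> L f x"
  using assms unfolding positive_linear_operator_def by auto

text \<open>An operator on \<open>C[0,1]\<close> does not see the values outside \<open>[0,1]\<close>.\<close>

lemma positive_linear_operator_cong: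
  assumes L: "positive_linear_operator L" and f: "f \<in> C01" and fg: "\<And>t. t \<in> {0..1} \<Longrightarrow> f t = g t"
    and x: "x \<in> {0..1}"
  shows "L f x = L g x"
proof -
  have g: "g \<in> C01"
    using f fg continuous_on_cong[of "{0..1}" "{0..1}" f g] by (auto simp: C01_def)
  have mono: "L u x \<le> L v x" if "u \<in> C01" "v \<in> C01" "\<And>t. t \<in> {0..1} \<Longrightarrow> u t = v t" for u v
  proof -
    have m: "(\<lambda>t. (-1) * u t) \<in> C01" and d: "(\<lambda>t. v t + (-1) * u t) \<in> C01"
      using that by (auto simp: C01_def intro!: continuous_intros)
    have "0 \<le> L (\<lambda>t. v t + (-1) * u t) x"
      by (rule operator_nonneg[OF L d x]) (simp add: that(3))
    also have "\<dots> = L v x + L (\<lambda>t. (-1) * u t) x"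
      by (rule operator_add[OF L that(2) x m])
    also have "L (\<lambda>t. (-1) * u t) x = (-1) * L u x"
      by (rule operator_scale[OF L that(1) x])
    finally show ?thesis by simp
  qed
  show ?thesis using mono[OF f g] mono[OF g f] fg by fastforce
qed

lemma L_psi_bounds:
  assumes "positive_linear_operator L" "preserves_linear L" and x: "x \<in> {0..1}"
  shows "0 \<le> L psi x \<and> L psi x \<le> psi x"
proof -
  note L = assms(1)
  define l where "l = (\<lambda>t. x^2 * e 0 t + (1 - 2*x) * e 1 t)"
  have cont: "psi \<in> C01" "e 0 \<in> C01" "e 1 \<in> C01" "(\<lambda>t. x^2 * e 0 t) \<in> C01"
    "(\<lambda>t. (1 - 2*x) * e 1 t) \<in> C01" "l \<in> C01" "(\<lambda>t. (-1) * psi t) \<in> C01"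
    "(\<lambda>t. l t + (-1) * psi t) \<in> C01"
    unfolding C01_def psi_def[abs_def] e_def[abs_def] l_def
    by (auto intro!: continuous_intros)
  have 1: "0 \<le> L psi x"
    by (rule operator_nonneg[OF L cont(1) x]) (simp add: psi_def)
  have "l t + (-1) * psi t = (t - x)^2" for t
    by (simp add: l_def e_def psi_def power2_eq_square algebra_simps)
  then have "0 \<le> l t + (-1) * psi t" for t by (metis zero_le_power2)
  then have "0 \<le> L (\<lambda>t. l t + (-1) * psi t) x" by (rule operator_nonneg[OF L cont(8) x])
  also have "\<dots> = L l x + L (\<lambda>t. (-1) * psi t) x"
    by (rule operator_add[OF L cont(6) x cont(7)])
  also have "L (\<lambda>t. (-1) * psi t) x = (-1) * L psi x"
    by (rule operator_scale[OF L cont(1) x])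
  also have "L l x = L (\<lambda>t. x^2 * e 0 t) x + L (\<lambda>t. (1 - 2*x) * e 1 t) x"
    unfolding l_def by (rule operator_add[OF L cont(4) x cont(5)])
  also have "L (\<lambda>t. x^2 * e 0 t) x = x^2 * L (e 0) x"
    by (rule operator_scale[OF L cont(2) x])
  also have "L (\<lambda>t. (1 - 2*x) * e 1 t) x = (1 - 2*x) * L (e 1) x"
    by (rule operator_scale[OF L cont(3) x])
  finally have "L psi x \<le> x^2 * e 0 x + (1 - 2*x) * e 1 x"
    using assms(2) x by (simp add: preserves_linear_def)
  also have "\<dots> = psi x" by (simp add: e_def psi_def power2_eq_square algebra_simps)
  finally show ?thesis using 1 by simp
qed

lemma nu_minimum:
  assumes "L \<in> Lambda"
  shows "nu L \<in> alpha L ` {0..1}" and "x \<in> {0..1} \<Longrightarrow> nu L \<le> alpha L x" and "0 < nu L"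
proof -
  have L: "positive_linear_operator L" "preserves_linear L" and n: "norm_psi (L psi) < 1"
    using assms by (auto simp: Lambda_def)
  have pos: "0 < psi x" if "x \<in> {0<..<1}" for x using that by (auto simp: psi_def)
  have le1: "\<bar>L psi x\<bar> / psi x \<le> 1" if "x \<in> {0<..<1}" for x
    using L_psi_bounds[OF L, of x] pos[OF that] that by (auto simp: divide_simps)
  have ub: "L psi x / psi x \<le> norm_psi (L psi)" if "x \<in> {0<..<1}" for x
  proof -
    have "L psi x / psi x = \<bar>L psi x\<bar> / psi x"
      using L_psi_bounds[OF L, of x] that by auto
    also have "\<dots> \<le> norm_psi (L psi)"
      unfolding norm_psi_def
      by (rule cSUP_upper[OF that]) (auto intro!: bdd_aboveI2[where M = 1] le1)
    finally show ?thesis .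
  qed
  have ge: "alpha L 0 \<le> alpha L x" for x
    using ub by (auto simp: alpha_def b_def)
  have eq: "nu L = alpha L 0"
    unfolding nu_def by (rule cInf_eq_minimum) (use ge in auto)
  show "nu L \<in> alpha L ` {0..1}" "x \<in> {0..1} \<Longrightarrow> nu L \<le> alpha L x" using eq ge by auto
  show "0 < nu L" using eq n by (simp add: alpha_def b_def)
qed

end

theory Submission
  imports Defs
begin

text \<open>
  If \<open>f\<close> lies below a parabola
  \<open>f x + p (t - x) + q (t - x)\<^sup>2\<close> near \<open>x\<close>, then it lies below that parabola plus
  \<open>C (t - x)\<^sup>4\<close> on all of \<open>[0,1]\<close>; applying \<open>L\<^sub>n\<close> at \<open>x\<close>, dividing by \<open>\<alpha>\<^sub>n(x)\<close> and letting
  \<open>n \<rightarrow> \<infinity>\<close> yields \<open>g x \<le> q\<close>. The same holds from above, so \<open>f\<close> solves \<open>f'' = 2 g\<close> in the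
  viscosity sense. Let \<open>F'' = 2 g\<close> classically. If \<open>f - F\<close> were not affine on some \<open>[a,b]\<close>, then
  up to sign \<open>f - F\<close> minus its chord, plus a small multiple of \<open>(t - a)\<^sup>2\<close>, would have an interior
  maximum, where a strictly concave parabola touches \<open>f - F\<close>: a contradiction.
\<close>

section \<open>Viscosity solutions of \<open>f'' = 2 g\<close>\<close>

text \<open>In viscosity terms, the pair \<open>(p, 2 * q)\<close> is a second-order superjet of
  \<open>f\<close> at \<open>x\<close>, taken without a remainder term.\<close>

definition below_parabola :: "(real \<Rightarrow> real) \<Rightarrow> real \<Rightarrow> real \<Rightarrow> real \<Rightarrow> bool"
  where "below_parabola f x p q \<longleftrightarrow>
    (\<forall>\<^sub>F t in nhds x. f t \<le> f x + p * (t - x) + q * (t - x)\<^sup>2)"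

lemma below_parabola_add:
  assumes "below_parabola f x p q" "below_parabola h x p' q'"
  shows "below_parabola (\<lambda>t. f t + h t) x (p + p') (q + q')"
  using assms unfolding below_parabola_def
  by eventually_elim (simp add: algebra_simps)

lemma below_parabola_affine: "below_parabola (\<lambda>t. c + d * t) x d 0"
  by (simp add: below_parabola_def algebra_simps)

text \<open>Taylor's formula with Lagrange remainder has quadratic coefficient \<open>g y\<close> at
  an intermediate \<open>y\<close>; by continuity this is at most \<open>g x + d\<close> once
  \<open>t\<close> is near \<open>x\<close>.\<close>

lemma C2_below_parabola:
  fixes a b :: real and F :: "real \<Rightarrow> real"
  assumes F: "\<And>t. t \<in> {a<..<b} \<Longrightarrow> (F has_real_derivative G t) (at t)"
    and G: "\<And>t. t \<in> {a<..<b} \<Longrightarrow> (G has_real_derivative 2 * g t) (at t)"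
    and g: "isCont g x" and x: "x \<in> {a<..<b}" and "0 < d"
  shows "below_parabola F x (G x) (g x + d)"
proof -
  obtain r where r: "r > 0" "\<And>t. \<bar>t - x\<bar> < r \<Longrightarrow> \<bar>g t - g x\<bar> < d"
    using g \<open>0 < d\<close> unfolding continuous_at_real_range by force
  define s where "s = Min {r, x - a, b - x}"
  have s: "s > 0" "s \<le> r" "s \<le> x - a" "s \<le> b - x" using r x by (auto simp: s_def)
  have "F t \<le> F x + G x * (t - x) + (g x + d) * (t - x)\<^sup>2" if "\<bar>t - x\<bar> < s" for t
  proof (cases "t = x")
    case False
    \<comment> \<open>These are the successive derivatives of \<open>F\<close> for Taylor's formula;
      dividing \<open>2 * g\<close> by \<open>fact 2\<close> leaves the coefficient
      \<open>g\<close>.\<close>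
    define D where "D m = (if m = 0 then F else if m = 1 then G else (\<lambda>t. 2 * g t))" for m :: nat
    have "\<exists>y. (if t < x then t < y \<and> y < x else x < y \<and> y < t) \<and>
        F t = (\<Sum>m<2. D m x / fact m * (t - x) ^ m) + D 2 y / fact 2 * (t - x) ^ 2"
    proof (rule Taylor[where a = "min t x" and b = "max t x"])
      show "\<forall>m u. m < 2 \<and> min t x \<le> u \<and> u \<le> max t x \<longrightarrow> DERIV (D m) u :> D (Suc m) u"
      proof (intro allI impI)
        fix m :: nat and u assume "m < 2 \<and> min t x \<le> u \<and> u \<le> max t x"
        then have "u \<in> {a<..<b}" "m = 0 \<or> m = 1" using that s by auto
        then show "DERIV (D m) u :> D (Suc m) u" using F G by (auto simp: D_def)
      qed
    qed (use False in \<open>auto simp: D_def\<close>)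
    then obtain y where y: "if t < x then t < y \<and> y < x else x < y \<and> y < t"
      and e: "F t = F x + G x * (t - x) + g y * (t - x)\<^sup>2"
      by (auto simp: D_def numeral_2_eq_2 lessThan_Suc)
    have "\<bar>y - x\<bar> < r" using y that s by (auto split: if_splits)
    then have "g y \<le> g x + d" using r(2)[of y] by linarith
    then show ?thesis using e by (simp add: mult_right_mono)
  qed simp
  then show ?thesis unfolding below_parabola_def eventually_nhds_metric
    using s(1) by (auto simp: dist_real_def)
qed

text \<open>A maximum principle: a positive value would survive a small convex perturbation, whose
  interior maximum produces a strictly concave parabola touching \<open>u\<close> from
  above.\<close>

lemma nonpos_between_zeros:
  fixes a b :: real and u :: "real \<Rightarrow> real"
  assumes cont: "continuous_on {a..b} u" and "u a = 0" "u b = 0"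
    and touch: "\<And>x p q. x \<in> {a<..<b} \<Longrightarrow> below_parabola u x p q \<Longrightarrow> 0 \<le> q"
    and y: "y \<in> {a..b}"
  shows "u y \<le> 0"
proof (rule ccontr)
  assume "\<not> u y \<le> 0"
  then have m: "u y > 0" by simp
  have ab: "a < b" using y m assms(2,3) by (cases "a = b") auto
  \<comment> \<open>With this size the perturbed function is \<open>0\<close> at \<open>a\<close>
    and \<open>u y / 2\<close> at \<open>b\<close>, both below \<open>u y\<close>, so its maximum
    cannot lie at an endpoint.\<close>
  define c where "c = u y / (2 * (b - a)\<^sup>2)"
  have c: "c > 0" "c * (b - a)\<^sup>2 = u y / 2" using m ab by (auto simp: c_def)
  obtain x where x: "x \<in> {a..b}"
    and max: "\<And>t. t \<in> {a..b} \<Longrightarrow> u t + c * (t - a)\<^sup>2 \<le> u x + c * (x - a)\<^sup>2"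
    using continuous_attains_sup[of "{a..b}" "\<lambda>t. u t + c * (t - a)\<^sup>2"] cont ab
    by (force intro!: continuous_intros)
  have "u y \<le> u x + c * (x - a)\<^sup>2"
    using max[OF y] c(1) by (smt (verit) mult_nonneg_nonneg zero_le_power2)
  then have "x \<noteq> a" "x \<noteq> b" using m c assms(2,3) by auto
  then have xi: "x \<in> {a<..<b}" using x by auto
  have "\<forall>\<^sub>F t in nhds x. t \<in> {a<..<b}" using xi by (intro eventually_nhds_in_open) auto
  \<comment> \<open>Maximality gives \<open>u t \<le> u x + c * ((x - a)^2 - (t - a)^2)\<close>;
    expanding the difference of squares about \<open>x\<close> yields these coefficients.\<close>
  then have "below_parabola u x (- 2 * c * (x - a)) (- c)"
    unfolding below_parabola_def
    by eventually_elim (use max in \<open>force simp: power2_eq_square algebra_simps\<close>)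
  from touch[OF xi this] show False using c by simp
qed

text \<open>The inequality \<open>f'' \<ge> 2 g\<close> in the viscosity sense, a touching parabola
  having second derivative \<open>2 * q\<close>. Supersolutions are expressed by negating both
  \<open>f\<close> and \<open>g\<close>.\<close>

definition viscosity_subsolution :: "real set \<Rightarrow> (real \<Rightarrow> real) \<Rightarrow> (real \<Rightarrow> real) \<Rightarrow> bool"
  where "viscosity_subsolution S f g \<longleftrightarrow>
    (\<forall>x\<in>S. \<forall>p q. below_parabola f x p q \<longrightarrow> g x \<le> q)"

text \<open>A parabola above \<open>u = f - F - (c + d t)\<close>, added to one above
  \<open>F\<close> and to the affine part, lies above \<open>f\<close>. The subsolution property
  then cancels \<open>g x\<close> and leaves \<open>0 \<le> q + r\<close> for every
  \<open>r > 0\<close>, so the maximum principle applies to \<open>u\<close>.\<close>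

lemma subsolution_below_chord:
  fixes a b :: real and f g F G :: "real \<Rightarrow> real"
  assumes sub: "viscosity_subsolution {a<..<b} f g"
    and f: "continuous_on {a..b} f" and g: "continuous_on {a<..<b} g"
    and Fc: "continuous_on {a..b} F"
    and F: "\<And>t. t \<in> {a<..<b} \<Longrightarrow> (F has_real_derivative G t) (at t)"
    and G: "\<And>t. t \<in> {a<..<b} \<Longrightarrow> (G has_real_derivative 2 * g t) (at t)"
    and ends: "f a = F a + c + d * a" "f b = F b + c + d * b"
    and y: "y \<in> {a..b}"
  shows "f y \<le> F y + c + d * y"
proof -
  define u where "u t = f t + (- F t) + (- c + (- d) * t)" for t
  have "u y \<le> 0"
  proof (rule nonpos_between_zeros[OF _ _ _ _ y])
    show "continuous_on {a..b} u"
      unfolding u_def using f Fc by (intro continuous_intros)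
    fix x p q assume x: "x \<in> {a<..<b}" and q: "below_parabola u x p q"
    have gx: "isCont g x" using g x by (simp add: continuous_on_eq_continuous_at)
    have "0 \<le> q + r" if "0 < r" for r
    proof -
      have "below_parabola (\<lambda>t. u t + F t + (c + d * t)) x (p + G x + d) (q + (g x + r) + 0)"
        by (intro below_parabola_add q below_parabola_affine C2_below_parabola[OF F G gx x that])
      then have "below_parabola f x (p + G x + d) (q + (g x + r))"
        by (simp add: u_def algebra_simps)
      then show ?thesis using sub x unfolding viscosity_subsolution_def by fastforce
    qed
    then show "0 \<le> q" using field_le_epsilon by blast
  qed (use ends in \<open>auto simp: u_def\<close>)
  then show ?thesis by (simp add: u_def)
qed

text \<open>Comparison from both sides with a double antiderivative \<open>F\<close> of
  \<open>2 g\<close> forces \<open>f - F\<close> to equal its chord, so \<open>f\<close> inherits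
  the regularity of \<open>F\<close>.\<close>

lemma viscosity_solution_local:
  fixes a b :: real and f g :: "real \<Rightarrow> real"
  assumes sub: "viscosity_subsolution {a<..<b} f g"
    and super: "viscosity_subsolution {a<..<b} (\<lambda>t. - f t) (\<lambda>t. - g t)"
    and f: "continuous_on {a..b} f" and g: "continuous_on {a..b} g" and ab: "a < b"
  obtains h where "\<And>t. t \<in> {a<..<b} \<Longrightarrow> (f has_real_derivative h t) (at t)"
    and "\<And>t. t \<in> {a<..<b} \<Longrightarrow> (h has_real_derivative 2 * g t) (at t)"
proof -
  have "continuous_on {a..b} (\<lambda>t. 2 * g t)" using g by (intro continuous_intros)
  then obtain G where G: "\<And>t. t \<in> {a..b} \<Longrightarrow> (G has_real_derivative 2 * g t) (at t within {a..b})"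
    using antiderivative_continuous[of a b "\<lambda>t. 2 * g t"]
    by (metis has_real_derivative_iff_has_vector_derivative)
  then have "continuous_on {a..b} G" by (rule DERIV_continuous_on)
  then obtain F where F: "\<And>t. t \<in> {a..b} \<Longrightarrow> (F has_real_derivative G t) (at t within {a..b})"
    using antiderivative_continuous[of a b G]
    by (metis has_real_derivative_iff_has_vector_derivative)
  then have Fc: "continuous_on {a..b} F" by (rule DERIV_continuous_on)
  have F': "(F has_real_derivative G t) (at t)" "(G has_real_derivative 2 * g t) (at t)"
    if "t \<in> {a<..<b}" for t
    using F[of t] G[of t] that at_within_Icc_at[of a t b] by auto
  have gi: "continuous_on {a<..<b} g" by (rule continuous_on_subset[OF g]) auto
  \<comment> \<open>The line \<open>c + d * t\<close> interpolates \<open>f - F\<close> at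
    \<open>a\<close> and \<open>b\<close>.\<close>
  define d where "d = ((f b - F b) - (f a - F a)) / (b - a)"
  define c where "c = f a - F a - d * a"
  have "d * (b - a) = (f b - F b) - (f a - F a)" using ab by (simp add: d_def)
  then have ends: "f a = F a + c + d * a" "f b = F b + c + d * b"
    by (auto simp: c_def algebra_simps)
  have eq: "f t = F t + c + d * t" if "t \<in> {a..b}" for t
  proof (rule antisym)
    show "f t \<le> F t + c + d * t"
      by (rule subsolution_below_chord[OF sub f gi Fc F' ends that])
    have "- f t \<le> - F t + (- c) + (- d) * t"
      by (rule subsolution_below_chord[OF super, where G = "\<lambda>t. - G t"])
        (use f gi Fc F' ends that in \<open>auto intro!: continuous_intros derivative_eq_intros\<close>)
    then show "F t + c + d * t \<le> f t" by simp
  qed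
  show thesis
  proof
    fix t assume t: "t \<in> {a<..<b}"
    have "((\<lambda>t. F t + c + d * t) has_real_derivative G t + d) (at t)"
      using F'[OF t] by (auto intro!: derivative_eq_intros)
    then show "(f has_real_derivative G t + d) (at t)"
      by (rule has_field_derivative_transform_within_open[where S = "{a<..<b}"])
        (use t eq in auto)
    show "((\<lambda>t. G t + d) has_real_derivative 2 * g t) (at t)"
      using F'[OF t] by (auto intro!: derivative_eq_intros)
  qed
qed

text \<open>Continuity is given only on the open interval, so the local result is applied on a
  compact interval around each point; near that point \<open>deriv f\<close> coincides with the
  local derivative \<open>h\<close>.\<close>

lemma viscosity_solution_C2:
  assumes sub: "viscosity_subsolution {0<..<1} f g"
    and super: "viscosity_subsolution {0<..<1} (\<lambda>t. - f t) (\<lambda>t. - g t)"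
    and f: "continuous_on {0<..<1} f" and g: "continuous_on {0<..<1} g"
  shows "f \<in> C_open 2 \<and> (\<forall>x\<in>{0<..<1}. g x = 1 / 2 * (deriv ^^ 2) f x)"
proof -
  have loc: "f differentiable (at x) \<and> deriv f differentiable (at x) \<and> deriv (deriv f) x = 2 * g x"
    if x: "x \<in> {0<..<1}" for x
  proof -
    define a b where "a = x / 2" and "b = (1 + x) / 2"
    have ab: "a < b" "x \<in> {a<..<b}" "{a..b} \<subseteq> {0<..<1}" using x by (auto simp: a_def b_def)
    have sub': "{a<..<b} \<subseteq> {0<..<1}" using ab(3) by fastforce
    obtain h where h: "\<And>t. t \<in> {a<..<b} \<Longrightarrow> (f has_real_derivative h t) (at t)"
      and h': "\<And>t. t \<in> {a<..<b} \<Longrightarrow> (h has_real_derivative 2 * g t) (at t)"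
    proof (rule viscosity_solution_local)
      show "viscosity_subsolution {a<..<b} f g" "viscosity_subsolution {a<..<b} (\<lambda>t. - f t) (\<lambda>t. - g t)"
        using sub super sub' unfolding viscosity_subsolution_def by blast+
    qed (use f g ab in \<open>auto intro: continuous_on_subset\<close>)
    have "(deriv f has_real_derivative 2 * g x) (at x)"
      by (rule has_field_derivative_transform_within_open[OF h'[OF ab(2)], where S = "{a<..<b}"])
        (use ab h in \<open>auto intro!: DERIV_imp_deriv[symmetric]\<close>)
    then show ?thesis
      using h[OF ab(2)] DERIV_imp_deriv real_differentiable_def by blast
  qed
  have "continuous_on {0<..<1} (deriv (deriv f))"
    using continuous_on_cong[of "{0<..<1}" "{0<..<1}" "deriv (deriv f)" "\<lambda>x. 2 * g x"] loc g
    by (auto intro!: continuous_intros)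
  then show ?thesis
    using loc unfolding C_open_def by (auto simp: numeral_2_eq_2 less_Suc_eq)
qed

section \<open>Operators preserving linear functions\<close>

lemma operator_mono:
  assumes L: "positive_linear_operator L" and f: "f \<in> C01" and h: "h \<in> C01"
    and le: "\<And>t. t \<in> {0..1} \<Longrightarrow> f t \<le> h t" and x: "x \<in> {0..1}"
  shows "L f x \<le> L h x"
proof -
  have m: "(\<lambda>t. (-1) * f t) \<in> C01" and d: "(\<lambda>t. h t + (-1) * f t) \<in> C01"
    using f h by (auto simp: C01_def intro!: continuous_intros)
  have "0 \<le> L (\<lambda>t. h t + (-1) * f t) x"
    by (rule operator_nonneg[OF L d x]) (simp add: le)
  then show ?thesis using operator_add[OF L h x m] operator_scale[OF L f x, of "-1"] by simp
qed

lemma operator_affine: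
  assumes L: "positive_linear_operator L" "preserves_linear L" and x: "x \<in> {0..1}"
  shows "L (\<lambda>t. c + d * t) x = c + d * x"
proof -
  have C: "e 0 \<in> C01" "e 1 \<in> C01" "(\<lambda>t. c * e 0 t) \<in> C01" "(\<lambda>t. d * e 1 t) \<in> C01"
    unfolding C01_def e_def[abs_def] by (auto intro!: continuous_intros)
  have "L (\<lambda>t. c * e 0 t + d * e 1 t) x = c * L (e 0) x + d * L (e 1) x"
    using operator_add[OF L(1) C(3) x C(4)] operator_scale[OF L(1) C(1) x]
      operator_scale[OF L(1) C(2) x] by simp
  then show ?thesis using L(2) x by (simp add: preserves_linear_def e_def)
qed

text \<open>Since \<open>(t - x)^2 = x^2 + (1 - 2 x) t - psi t\<close> and \<open>L\<close> fixes
  the affine part, the moment is \<open>psi x - L psi x\<close>.\<close>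

lemma moment_2:
  assumes "L \<in> Lambda" and x: "x \<in> {0<..<1}"
  shows "moment L 2 x = alpha L x * psi x"
proof -
  have L: "positive_linear_operator L" "preserves_linear L" using assms by (auto simp: Lambda_def)
  have x': "x \<in> {0..1}" using x by auto
  have C: "psi \<in> C01" "(\<lambda>t. (-1) * psi t) \<in> C01" "(\<lambda>t. x\<^sup>2 + (1 - 2 * x) * t) \<in> C01"
    unfolding C01_def psi_def[abs_def] by (auto intro!: continuous_intros)
  have "(\<lambda>t. (e 1 t - x * e 0 t) ^ 2) = (\<lambda>t. (x\<^sup>2 + (1 - 2 * x) * t) + (-1) * psi t)"
    by (auto simp: e_def psi_def power2_eq_square algebra_simps)
  then have "moment L 2 x = (x\<^sup>2 + (1 - 2 * x) * x) - L psi x"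
    unfolding moment_def
    using operator_add[OF L(1) C(3) x' C(2)] operator_scale[OF L(1) C(1) x', of "-1"]
      operator_affine[OF L x', of "x\<^sup>2" "1 - 2 * x"] by simp
  also have "\<dots> = psi x - L psi x" by (simp add: psi_def power2_eq_square algebra_simps)
  also have "\<dots> = alpha L x * psi x"
    using x by (simp add: alpha_def b_def psi_def field_simps)
  finally show ?thesis .
qed

text \<open>The slope \<open>p\<close> disappears because \<open>L\<close> reproduces the affine
  part, whose value at \<open>x\<close> is \<open>c\<close>.\<close>

lemma operator_quartic:
  assumes L: "positive_linear_operator L" "preserves_linear L" and x: "x \<in> {0..1}"
  shows "L (\<lambda>t. c + p * (t - x) + q * (t - x)\<^sup>2 + C * (t - x) ^ 4) x
    = c + q * moment L 2 x + C * moment L 4 x"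
proof -
  have M: "(\<lambda>t. (t - x) ^ k) \<in> C01" "(\<lambda>t. a * (t - x) ^ k) \<in> C01" "(\<lambda>t. a + d * t) \<in> C01"
    "(\<lambda>t. a + d * t + q * (t - x)\<^sup>2) \<in> C01" for k a d
    unfolding C01_def by (auto intro!: continuous_intros)
  have "(\<lambda>t. c + p * (t - x) + q * (t - x)\<^sup>2 + C * (t - x) ^ 4)
    = (\<lambda>t. (c - p * x) + p * t + q * (t - x)\<^sup>2 + C * (t - x) ^ 4)"
    by (simp add: algebra_simps)
  then show ?thesis
    using operator_add[OF L(1) M(4) x M(2), of "c - p * x" p C 4]
      operator_add[OF L(1) M(3) x M(2), of "c - p * x" p q 2]
      operator_scale[OF L(1) M(1) x, of q 2] operator_scale[OF L(1) M(1) x, of C 4]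
      operator_affine[OF L x, of "c - p * x" p]
    by (simp add: moment_def e_def)
qed

section \<open>The comparison argument\<close>

text \<open>This makes the local bound global, as a positive operator requires. Within distance
  \<open>r\<close> of \<open>x\<close> the excess \<open>h\<close> is nonpositive; farther away
  \<open>(t - x)^4 \<ge> r^4\<close>, so \<open>K / r^4\<close> times the quartic dominates the
  bound \<open>K\<close> of \<open>h\<close>.\<close>

lemma below_quartic:
  assumes f: "f \<in> C01" and q: "below_parabola f x p q"
  obtains C where "0 \<le> C"
    and "\<And>t. t \<in> {0..1} \<Longrightarrow> f t \<le> f x + p * (t - x) + q * (t - x)\<^sup>2 + C * (t - x) ^ 4"
proof -
  define h where "h t = f t - (f x + p * (t - x) + q * (t - x)\<^sup>2)" for t
  obtain r where r: "r > 0" "\<And>t. \<bar>t - x\<bar> < r \<Longrightarrow> h t \<le> 0"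
    using q unfolding below_parabola_def eventually_nhds_metric dist_real_def h_def by auto
  have "continuous_on {0..1} h"
    using f unfolding h_def C01_def by (auto intro!: continuous_intros)
  then have "bounded (h ` {0..1})"
    by (intro compact_imp_bounded compact_continuous_image) auto
  then obtain K where K: "K > 0" "\<And>t. t \<in> {0..1} \<Longrightarrow> \<bar>h t\<bar> \<le> K"
    unfolding bounded_pos by auto
  have "h t \<le> K / r ^ 4 * (t - x) ^ 4" if t: "t \<in> {0..1}" for t
  proof (cases "\<bar>t - x\<bar> < r")
    case True
    moreover have "0 \<le> K / r ^ 4 * (t - x) ^ 4" using r(1) K(1) by simp
    ultimately show ?thesis using r(2)[of t] by linarith
  next
    case False
    then have "r ^ 4 \<le> \<bar>t - x\<bar> ^ 4" using r by (intro power_mono) auto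
    then have "K * r ^ 4 \<le> K * (t - x) ^ 4" using K(1) by (simp add: power_even_abs)
    then have "K \<le> K / r ^ 4 * (t - x) ^ 4" using r(1) by (simp add: field_simps)
    then show ?thesis using K(2)[OF t] by linarith
  qed
  then show thesis using that[of "K / r ^ 4"] K(1) r(1) by (force simp: h_def)
qed

text \<open>After division by \<open>alpha (L n) x\<close> the quadratic term contributes
  \<open>q * psi x\<close>, and the quartic one at most \<open>C * c n * psi x\<close>. This tends
  to \<open>0\<close> because \<open>C\<close> depends on \<open>x\<close> but not on
  \<open>n\<close>.\<close>

lemma limit_le_parabola:
  assumes L: "\<And>n. L n \<in> Lambda"
    and M: "unif_smallo (\<lambda>n x. moment (L n) 4 x) (\<lambda>n x. moment (L n) 2 x)"
    and f: "f \<in> C01" and x: "x \<in> {0<..<1}"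
    and lim: "(\<lambda>n. (L n f x - f x) / alpha (L n) x) \<longlonglongrightarrow> l * psi x"
    and q: "below_parabola f x p q"
  shows "l \<le> q"
proof -
  obtain C where C: "0 \<le> C"
    and le: "\<And>t. t \<in> {0..1} \<Longrightarrow> f t \<le> f x + p * (t - x) + q * (t - x)\<^sup>2 + C * (t - x) ^ 4"
    using below_quartic[OF f q] by blast
  obtain c where c: "c \<longlonglongrightarrow> 0" "\<And>n x. x \<in> {0..1} \<Longrightarrow> moment (L n) 4 x \<le> c n * moment (L n) 2 x"
    using M unfolding unif_smallo_def by blast
  have x': "x \<in> {0..1}" and psi: "0 < psi x" using x by (auto simp: psi_def)
  have "(L n f x - f x) / alpha (L n) x \<le> (q + C * c n) * psi x" for n
  proof -
    have P: "positive_linear_operator (L n)" "preserves_linear (L n)"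
      using L[of n] by (auto simp: Lambda_def)
    have a: "0 < alpha (L n) x" using nu_minimum(2,3)[OF L[of n]] x' by (meson less_le_trans)
    have "L n f x \<le> L n (\<lambda>t. f x + p * (t - x) + q * (t - x)\<^sup>2 + C * (t - x) ^ 4) x"
      by (rule operator_mono[OF P(1) f _ le x']) (auto simp: C01_def intro!: continuous_intros)
    also have "\<dots> = f x + q * moment (L n) 2 x + C * moment (L n) 4 x"
      by (rule operator_quartic[OF P x'])
    also have "\<dots> \<le> f x + q * moment (L n) 2 x + C * (c n * moment (L n) 2 x)"
      using c(2)[OF x', of n] C by (simp add: mult_left_mono)
    finally show ?thesis
      using a by (simp add: moment_2[OF L x] divide_le_eq algebra_simps)
  qed
  moreover have "(\<lambda>n. (q + C * c n) * psi x) \<longlonglongrightarrow> (q + C * 0) * psi x"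
    by (intro tendsto_intros c)
  ultimately have "l * psi x \<le> (q + C * 0) * psi x"
    using lim by (intro LIMSEQ_le) auto
  then show ?thesis using psi by simp
qed

section \<open>Pointwise convergence from convergence in the weighted norm\<close>

text \<open>Besides unpacking the sum of spaces, this supplies continuity on the closed interval and
  a single \<open>K\<close> measuring the distance to an affine function in units of
  \<open>psi\<close>.\<close>

lemma C_psi_plus_Pi1_E:
  assumes "f \<in> C_psi + Pi1"
  obtains c d K where "f \<in> C01" "0 \<le> K"
    "\<And>x. x \<in> {0..1} \<Longrightarrow> \<bar>f x - (c + d * x)\<bar> \<le> K * psi x"
proof -
  obtain u v where f: "f = u + v" and "u \<in> C_psi" "v \<in> Pi1"
    using assms by (auto simp: set_plus_def)
  obtain h where h: "bounded (h ` {0..1})" "continuous_on {0<..<1} h"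
    and u: "\<And>x. x \<in> {0..1} \<Longrightarrow> u x = psi x * h x"
    using \<open>u \<in> C_psi\<close> by (auto simp: C_psi_def B01_def C_open_def)
  obtain P where P: "degree P \<le> 1" "\<And>x. x \<in> {0..1} \<Longrightarrow> v x = poly P x"
    using \<open>v \<in> Pi1\<close> by (auto simp: Pi1_def)
  obtain c d where "P = [:c, d:]" using degree1_coeffs[of P] P(1)
    by (metis degree_eq_zeroE le_eq_less_or_eq less_one pCons_0_0)
  then have v: "v x = c + d * x" if "x \<in> {0..1}" for x using P(2)[OF that] by (simp add: mult.commute)
  obtain K where K: "K > 0" "\<And>x. x \<in> {0..1} \<Longrightarrow> \<bar>h x\<bar> \<le> K"
    using h(1) unfolding bounded_pos by auto
  have psi: "0 \<le> psi x" if "x \<in> {0..1}" for x using that by (auto simp: psi_def)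
  have bd: "\<bar>u x\<bar> \<le> K * psi x" if "x \<in> {0..1}" for x
    using u[OF that] mult_left_mono[OF K(2)[OF that] psi[OF that]] psi[OF that]
    by (simp add: abs_mult mult.commute)
  have "(u \<longlongrightarrow> u x) (at x within {0..1})" if x: "x \<in> {0..1}" for x
  proof (cases "x \<in> {0<..<1}")
    case True
    have "continuous_on {0<..<1} (\<lambda>x. psi x * h x)"
      unfolding psi_def using h(2) by (intro continuous_intros)
    then have "continuous_on {0<..<1} u"
      using continuous_on_cong[of "{0<..<1}" "{0<..<1}" u "\<lambda>x. psi x * h x"] u by auto
    then have "isCont u x" using True by (simp add: continuous_on_eq_continuous_at)
    then show ?thesis by (simp add: isCont_def Lim_at_imp_Lim_at_within)
  next
    case False
    \<comment> \<open>At an endpoint only boundedness of \<open>h\<close> is available; continuity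
      of \<open>u\<close> follows by squeezing between multiples of \<open>psi\<close>, which
      vanishes there.\<close>
    then have z: "psi x = 0" using x by (auto simp: psi_def)
    have "((\<lambda>t. K * psi t) \<longlongrightarrow> K * psi x) (at x within {0..1})"
      unfolding psi_def by (intro tendsto_intros)
    then have "((\<lambda>t. K * psi t) \<longlongrightarrow> 0) (at x within {0..1})" by (simp add: z)
    then have "(u \<longlongrightarrow> 0) (at x within {0..1})"
      by (rule Lim_null_comparison[rotated])
        (use bd in \<open>auto simp: eventually_at_filter intro!: always_eventually\<close>)
    then show ?thesis using u[OF x] z by simp
  qed
  then have "continuous_on {0..1} u" by (simp add: continuous_on_def)
  then have "continuous_on {0..1} (\<lambda>x. u x + (c + d * x))" by (intro continuous_intros)
  then have "f \<in> C01"
    using continuous_on_cong[of "{0..1}" "{0..1}" f "\<lambda>x. u x + (c + d * x)"] v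
    by (auto simp: C01_def f)
  then show thesis using that[of K c d] K bd v by (simp add: f)
qed

text \<open>Both \<open>f\<close> and \<open>L f\<close> lie within \<open>K * psi\<close> of the
  same affine function, the latter because \<open>L psi \<le> psi\<close>; hence the factor
  \<open>2\<close>.\<close>

lemma operator_diff_bound:
  assumes "L \<in> Lambda" and f: "f \<in> C01" and "0 \<le> K"
    and bd: "\<And>x. x \<in> {0..1} \<Longrightarrow> \<bar>f x - (c + d * x)\<bar> \<le> K * psi x"
    and x: "x \<in> {0..1}"
  shows "\<bar>L f x - f x\<bar> \<le> 2 * K * psi x"
proof -
  have L: "positive_linear_operator L" "preserves_linear L" using assms by (auto simp: Lambda_def)
  have C: "psi \<in> C01" "(\<lambda>t. k * psi t) \<in> C01" "(\<lambda>t. c + d * t) \<in> C01"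
    "(\<lambda>t. c + d * t + k * psi t) \<in> C01" for k
    unfolding C01_def psi_def[abs_def] by (auto intro!: continuous_intros)
  have val: "L (\<lambda>t. c + d * t + k * psi t) x = c + d * x + k * L psi x" for k
    using operator_add[OF L(1) C(3) x C(2)] operator_scale[OF L(1) C(1) x]
      operator_affine[OF L x] by simp
  have "L f x \<le> c + d * x + K * L psi x"
    unfolding val[symmetric] using bd by (intro operator_mono[OF L(1) f C(4) _ x]) (smt (verit))
  moreover have "c + d * x + (- K) * L psi x \<le> L f x"
    unfolding val[symmetric] using bd by (intro operator_mono[OF L(1) C(4) f _ x]) (smt (verit) minus_mult_left)
  moreover have "K * L psi x \<le> K * psi x"
    using L_psi_bounds[OF L x] \<open>0 \<le> K\<close> by (simp add: mult_left_mono)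
  ultimately show ?thesis using bd[OF x] by (simp add: abs_le_iff)
qed

text \<open>The real-valued supremum dominates its members only for a family bounded above; the
  constant \<open>K\<close> certifies this.\<close>

lemma norm_psi_upper:
  assumes "\<And>t. t \<in> {0<..<1} \<Longrightarrow> \<bar>h t\<bar> \<le> K * psi t" and x: "x \<in> {0<..<1}"
  shows "\<bar>h x\<bar> / psi x \<le> norm_psi h"
  unfolding norm_psi_def
proof (rule cSUP_upper[OF x], rule bdd_aboveI2)
  fix t :: real assume "t \<in> {0<..<1}"
  then show "\<bar>h t\<bar> / psi t \<le> K" using assms(1)[of t] by (simp add: psi_def divide_simps)
qed

lemma pointwise_limit:
  assumes L: "\<And>n. L n \<in> Lambda" and f: "f \<in> C_psi + Pi1" and g: "g \<in> B01"
    and lim: "(\<lambda>n. norm_psi (\<lambda>x. 1 / alpha (L n) x * (L n f x - f x) - g x * psi x)) \<longlonglongrightarrow> 0"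
    and x: "x \<in> {0<..<1}"
  shows "(\<lambda>n. (L n f x - f x) / alpha (L n) x) \<longlonglongrightarrow> g x * psi x"
proof -
  obtain c d K where f': "f \<in> C01" and K: "0 \<le> K"
    and bd: "\<And>x. x \<in> {0..1} \<Longrightarrow> \<bar>f x - (c + d * x)\<bar> \<le> K * psi x"
    by (rule C_psi_plus_Pi1_E[OF f]) (rule that)
  obtain B where B: "\<And>t. t \<in> {0..1} \<Longrightarrow> \<bar>g t\<bar> \<le> B"
    using g unfolding B01_def bounded_pos by fastforce
  define D where "D n t = 1 / alpha (L n) t * (L n f t - f t) - g t * psi t" for n t
  \<comment> \<open>The bound may grow with \<open>n\<close> through \<open>nu (L n)\<close>: it
    only has to make \<open>norm_psi (D n)\<close> a genuine supremum for each fixed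
    \<open>n\<close>.\<close>
  have D: "\<bar>D n t\<bar> \<le> (2 * K / nu (L n) + B) * psi t" if "t \<in> {0<..<1}" for n t
  proof -
    have t: "t \<in> {0..1}" and p: "0 < psi t" using that by (auto simp: psi_def)
    have nu: "0 < nu (L n)" "nu (L n) \<le> alpha (L n) t" using nu_minimum[OF L] t by auto
    have "\<bar>(L n f t - f t) / alpha (L n) t\<bar> \<le> 2 * K * psi t / nu (L n)"
      unfolding abs_divide using operator_diff_bound[OF L f' K bd t] nu K p by (intro frac_le) auto
    moreover have "\<bar>g t * psi t\<bar> \<le> B * psi t"
      using B[OF t] p by (simp add: abs_mult mult_right_mono)
    moreover have "D n t = (L n f t - f t) / alpha (L n) t - g t * psi t" by (simp add: D_def)
    moreover have "(2 * K / nu (L n) + B) * psi t = 2 * K * psi t / nu (L n) + B * psi t"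
      by (simp add: distrib_right)
    ultimately show ?thesis by linarith
  qed
  have p: "0 < psi x" using x by (auto simp: psi_def)
  have "(\<lambda>n. norm_psi (D n) * psi x) \<longlonglongrightarrow> 0 * psi x"
    using lim unfolding D_def by (intro tendsto_intros)
  then have "(\<lambda>n. norm_psi (D n) * psi x) \<longlonglongrightarrow> 0" by simp
  then have "(\<lambda>n. D n x) \<longlonglongrightarrow> 0"
  proof (rule Lim_null_comparison[rotated])
    show "\<forall>\<^sub>F n in sequentially. norm (D n x) \<le> norm_psi (D n) * psi x"
      using norm_psi_upper[OF D x] p by (intro always_eventually) (simp add: divide_le_eq)
  qed
  then have "(\<lambda>n. D n x + g x * psi x) \<longlonglongrightarrow> 0 + g x * psi x" by (intro tendsto_intros)
  then show ?thesis by (simp add: D_def)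
qed

theorem theorem5:
  fixes L :: "nat \<Rightarrow> (real \<Rightarrow> real) \<Rightarrow> (real \<Rightarrow> real)" and f g :: "real \<Rightarrow> real"
  assumes "\<And>n. L n \<in> Lambda"
    and "unif_smallo (\<lambda>n x. moment (L n) 4 x) (\<lambda>n x. moment (L n) 2 x)"
    and "(\<lambda>n. eta (L n)) \<in> o(\<lambda>n. 1)"
    and "unif_smallo
           (\<lambda>n x. L n (\<lambda>t. psi t * \<bar>alpha (L n) t - alpha (L n) x * e 0 t\<bar>) x)
           (\<lambda>n x. (nu (L n))\<^sup>2 * psi x)"
    and "f \<in> C_psi + Pi1"
    and "g \<in> C_open 0 \<inter> B01"
    and "(\<lambda>n. norm_psi (\<lambda>x. 1 / alpha (L n) x * (L n f x - f x) - g x * psi x)) \<longlonglongrightarrow> 0"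
  shows "f \<in> C_open 2 \<and> (\<forall>x\<in>{0<..<1}. g x = 1 / 2 * (deriv ^^ 2) f x)"
proof (rule viscosity_solution_C2)
  have f: "f \<in> C01" by (rule C_psi_plus_Pi1_E[OF assms(5)])
  then have mf: "(\<lambda>t. - f t) \<in> C01" by (auto simp: C01_def intro!: continuous_intros)
  show "continuous_on {0<..<1} f"
    using f unfolding C01_def by (auto intro: continuous_on_subset)
  show "continuous_on {0<..<1} g" using assms(6) by (simp add: C_open_def)
  have lim: "(\<lambda>n. (L n f x - f x) / alpha (L n) x) \<longlonglongrightarrow> g x * psi x" if "x \<in> {0<..<1}" for x
    using pointwise_limit[OF assms(1,5) _ assms(7) that] assms(6) by blast
  show "viscosity_subsolution {0<..<1} f g"
    unfolding viscosity_subsolution_def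
    using limit_le_parabola[OF assms(1,2) f _ lim] by blast
  \<comment> \<open>By linearity \<open>-f\<close> satisfies the same limit relation with
    \<open>-g\<close>, so the upper comparison for \<open>-f\<close> yields the supersolution
    half.\<close>
  have "(\<lambda>n. (L n (\<lambda>t. - f t) x - - f x) / alpha (L n) x) \<longlonglongrightarrow> - g x * psi x"
    if x: "x \<in> {0<..<1}" for x
  proof -
    have "L n (\<lambda>t. - f t) x = - L n f x" for n
      using operator_scale[OF _ f, of "L n" x "-1"] assms(1)[of n] x by (auto simp: Lambda_def)
    then have "(L n (\<lambda>t. - f t) x - - f x) / alpha (L n) x = - ((L n f x - f x) / alpha (L n) x)" for n
      by (simp add: minus_divide_left)
    then show ?thesis using tendsto_minus[OF lim[OF x]] by simp
  qed
  then show "viscosity_subsolution {0<..<1} (\<lambda>t. - f t) (\<lambda>t. - g t)"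
    unfolding viscosity_subsolution_def
    using limit_le_parabola[OF assms(1,2) mf] by blast
qed

end
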